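(* (Monodromy spaces of types $(1/2,-,1/2)$, Painlevé III($D_8$), and $(-,-,5/2)$, Painlevé I.) (a) The affine scheme over $\mathbb{C}$ with coordinates $a,b,\ell_1,\ell_2,\ell_3,\ell_4$ and relations $\ell_1\ell_4-\ell_2\ell_3=1$ and $$\begin{pmatrix}\ell_1&\ell_2\\ \ell_3&\ell_4\end{pmatrix}\begin{pmatrix}-a&-1\\ 1&0\end{pmatrix}=\begin{pmatrix}-b&-1\\ 1&0\end{pmatrix}\begin{pmatrix}\ell_1&\ell_2\\ \ell_3&\ell_4\end{pmatrix}$$ is isomorphic to the affine cubic surface $x_1x_2x_3+x_1^2-x_2^2-1=0$ in $\mathbb{A}^3_{\mathbb{C}}$, and this surface is non-singular. (b) The affine scheme over $\mathbb{C}$ with coordinates $a_1,\dots,a_5$ and relations given by the matrix identity $$\begin{pmatrix}0&-1\\ 1&0\end{pmatrix}\begin{pmatrix}1&0\\ a_1&1\end{pmatrix}\begin{pmatrix}1&a_2\\ 0&1\end{pmatrix}\begin{pmatrix}1&0\\ a_3&1\end{pmatrix}\begin{pmatrix}1&a_4\\ 0&1\end{pmatrix}\begin{pmatrix}1&0\\ a_5&1\end{pmatrix}=\begin{pmatrix}1&0\\ 0&1\end{pmatrix}$$ is isomorphic, via the coordinates $a_3,a_4,a_5$, to the affine cubic surface $a_3a_4a_5+a_3+a_5+1=0$ in $\mathbb{A}^3_{\mathbb{C}}$, and this surface is non-singular. On it $a_2=1+a_4a_5$ and $a_1=-1-a_3a_4$.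
   Context: These schemes are the monodromy spaces (spaces of formal monodromy, Stokes matrices and links, on which the remaining base changes act trivially) for rank-two differential modules on $\mathbb{P}^1$ with trivial determinant that are, in (a), singular only at $0,\infty$, both ramified with Katz invariant $1/2$, and in (b), singular only at $\infty$ with Katz invariant $5/2$. No further information about their origin is needed for the claim. *)

theory Defs
  imports
    "HOL-Analysis.Cartesian_Space"
    "HOL-Algebra.QuotRing"
    "HOL-Library.Poly_Mapping"
begin

section \<open>Complex polynomials in the variables \<open>'v\<close>\<close>

text \<open>
  A polynomial is a finitely supported map from monomials (exponent vectors \<open>'v \<Rightarrow>\<^sub>0 nat\<close>) to
  coefficients, with the convolution product of \<^theory>\<open>HOL-Library.Poly_Mapping\<close>. For a finite type
  \<open>'v\<close> this is the coordinate ring of affine space over the complex numbers with coordinates \<open>'v\<close>.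
\<close>

type_synonym 'v cpoly = "('v \<Rightarrow>\<^sub>0 nat) \<Rightarrow>\<^sub>0 complex"

definition pconst :: "complex \<Rightarrow> 'v cpoly" where
  "pconst c = Poly_Mapping.single 0 c"

definition pvar :: "'v \<Rightarrow> 'v cpoly" where
  "pvar v = Poly_Mapping.single (Poly_Mapping.single v 1) 1"

definition peval :: "('v \<Rightarrow> complex) \<Rightarrow> 'v cpoly \<Rightarrow> complex" where
  "peval P f = (\<Sum>m\<in>Poly_Mapping.keys f.
     Poly_Mapping.lookup f m * (\<Prod>v\<in>Poly_Mapping.keys m. P v ^ Poly_Mapping.lookup m v))"

text \<open>
  The subtraction of exponent vectors below truncates only in terms whose coefficient is zero.
\<close>

definition partial_deriv :: "'v \<Rightarrow> 'v cpoly \<Rightarrow> 'v cpoly" where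
  "partial_deriv v f = (\<Sum>m\<in>Poly_Mapping.keys f.
     Poly_Mapping.single (m - Poly_Mapping.single v 1)
       (of_nat (Poly_Mapping.lookup m v) * Poly_Mapping.lookup f m))"

definition cpoly_ring :: "'v cpoly ring" where
  "cpoly_ring = \<lparr>carrier = UNIV, mult = (*), one = 1, zero = 0, add = (+)\<rparr>"

lemma cring_cpoly_ring: "cring (cpoly_ring :: 'v cpoly ring)"
proof (rule cringI)
  show "abelian_group (cpoly_ring :: 'v cpoly ring)"
    by (rule abelian_groupI)
      (auto simp: cpoly_ring_def ac_simps intro: exI[of _ "- x" for x])
  show "comm_monoid (cpoly_ring :: 'v cpoly ring)"
    by (rule comm_monoidI) (auto simp: cpoly_ring_def ac_simps)
qed (auto simp: cpoly_ring_def distrib_right)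


section \<open>Affine schemes of finite type over the complex numbers\<close>

text \<open>
  The affine scheme with coordinates \<open>'v\<close> and relations \<open>f = 0\<close> for \<open>f\<close> in \<open>F\<close> is the spectrum of
  the quotient of the polynomial ring by the ideal generated by \<open>F\<close> (not by its radical). It is
  represented by this quotient ring together with the classes of the constants, which give the
  structure of an algebra over the complex numbers.
\<close>

definition coord_ring :: "'v cpoly set \<Rightarrow> 'v cpoly set ring" where
  "coord_ring F = cpoly_ring Quot (Idl\<^bsub>cpoly_ring\<^esub> F)"

definition coord_class :: "'v cpoly set \<Rightarrow> 'v cpoly \<Rightarrow> 'v cpoly set" where
  "coord_class F f = (Idl\<^bsub>cpoly_ring\<^esub> F) +>\<^bsub>cpoly_ring\<^esub> f"

definition algebra_iso ::
    "'v cpoly set \<Rightarrow> 'w cpoly set \<Rightarrow> ('v cpoly set \<Rightarrow> 'w cpoly set) set" where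
  "algebra_iso F G =
     {\<phi> \<in> ring_iso (coord_ring F) (coord_ring G).
        \<forall>c. \<phi> (coord_class F (pconst c)) = coord_class G (pconst c)}"

text \<open>
  Affine schemes over the complex numbers are isomorphic (over the complex numbers) iff their
  coordinate rings are isomorphic as algebras; the isomorphism of rings goes in the opposite direction.
\<close>

definition affine_schemes_iso :: "'v cpoly set \<Rightarrow> 'w cpoly set \<Rightarrow> bool" where
  "affine_schemes_iso F G \<longleftrightarrow> algebra_iso G F \<noteq> {}"

text \<open>
  The hypersurface \<open>f = 0\<close> is non-singular if at each of its complex points the one-row Jacobian
  matrix of \<open>f\<close> has rank 1. Since the equation \<open>f\<close> itself is used, and not the reduced
  equation, this also makes the scheme reduced.
\<close>

definition nonsingular_hypersurface :: "'v cpoly \<Rightarrow> bool" where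
  "nonsingular_hypersurface f \<longleftrightarrow>
     (\<forall>P. peval P f = 0 \<longrightarrow> (\<exists>v. peval P (partial_deriv v f) \<noteq> 0))"


section \<open>Matrix relations\<close>

definition mat22 :: "'a::zero \<Rightarrow> 'a \<Rightarrow> 'a \<Rightarrow> 'a \<Rightarrow> 'a^2^2" where
  "mat22 a b c d = vector [vector [a, b], vector [c, d]]"

definition matrix_relations :: "'v cpoly^2^2 \<Rightarrow> 'v cpoly^2^2 \<Rightarrow> 'v cpoly set" where
  "matrix_relations M N = {M $ i $ j - N $ i $ j | i j. True}"


section \<open>The monodromy spaces and the cubic surfaces\<close>

datatype coords_D8 = A | B | L1 | L2 | L3 | L4

definition relations_D8 :: "coords_D8 cpoly set" where
  "relations_D8 =
     {pvar L1 * pvar L4 - pvar L2 * pvar L3 - 1} \<union>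
     matrix_relations
       (mat22 (pvar L1) (pvar L2) (pvar L3) (pvar L4) ** mat22 (- pvar A) (- 1) 1 0)
       (mat22 (- pvar B) (- 1) 1 0 ** mat22 (pvar L1) (pvar L2) (pvar L3) (pvar L4))"

datatype coords_x = X1 | X2 | X3

definition cubic_D8 :: "coords_x cpoly" where
  "cubic_D8 = pvar X1 * pvar X2 * pvar X3 + pvar X1 ^ 2 - pvar X2 ^ 2 - 1"

datatype coords_PI = A1 | A2 | A3 | A4 | A5

definition relations_PI :: "coords_PI cpoly set" where
  "relations_PI =
     matrix_relations
       (mat22 0 (- 1) 1 0 ** mat22 1 0 (pvar A1) 1 ** mat22 1 (pvar A2) 0 1 **
          mat22 1 0 (pvar A3) 1 ** mat22 1 (pvar A4) 0 1 ** mat22 1 0 (pvar A5) 1)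
       (mat22 1 0 0 1)"

text \<open>
  The surface for Painleve I lives in the affine 3-space with coordinates \<open>a\<^sub>3, a\<^sub>4, a\<^sub>5\<close>, named
  \<open>S3, S4, S5\<close> to keep them apart from the coordinates of the 5-dimensional space.
\<close>

datatype coords_S = S3 | S4 | S5

definition cubic_PI :: "coords_S cpoly" where
  "cubic_PI = pvar S3 * pvar S4 * pvar S5 + pvar S3 + pvar S5 + 1"

end

(*
  Both isomorphisms are given by mutually inverse substitutions, so only ideal memberships remain.

  (a) The off-determinant relations give l3 = - l2, l4 = l1 - a l2 and (b - a) l1 = (b - a) l2 = 0.
  Since l1 and l2 generate the unit ideal by the determinant relation, b = a, and what remains is
  l1^2 - a l1 l2 + l2^2 = 1. Put x1 = l1, x2 = i l2, x3 = i a.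

  (b) Write the relation as M N = 1 with N the product of the last three factors. As det N = 1, it
  is equivalent to M = adj N, whose diagonal entries express a1 and a2 through a3, a4, a5
  and whose lower left entry is the cubic; the remaining entry is a multiple of the cubic.
*)

theory Submission
  imports Defs
begin

section \<open>Evaluation of polynomials in complex algebras\<close>

lemma cpoly_sum_single:
  fixes f :: "'v cpoly"
  shows "f = (\<Sum>m\<in>Poly_Mapping.keys f. Poly_Mapping.single m (Poly_Mapping.lookup f m))"
  by (rule poly_mapping_eqI)
    (simp add: lookup_sum lookup_single when_def in_keys_iff)

text \<open>Identities additive in each argument need checking only on single terms; both product
  rules below apply this to each factor in turn.\<close>

lemma cpoly_monomial_induct [case_names single add]:
  fixes f :: "'v cpoly"
  assumes "\<And>m c. P (Poly_Mapping.single m c)"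
    and "\<And>f g. P f \<Longrightarrow> P g \<Longrightarrow> P (f + g)"
  shows "P f"
proof -
  have zero: "P 0"
    using assms(1)[of 0 0] by simp
  have "P (\<Sum>m\<in>M. Poly_Mapping.single m (Poly_Mapping.lookup f m))" if "finite M" for M
    using that by induction (auto intro: assms zero)
  then show ?thesis
    by (subst cpoly_sum_single) simp
qed

definition monom_eval :: "('v \<Rightarrow> 'r::comm_ring_1) \<Rightarrow> ('v \<Rightarrow>\<^sub>0 nat) \<Rightarrow> 'r" where
  "monom_eval x m = (\<Prod>v\<in>Poly_Mapping.keys m. x v ^ Poly_Mapping.lookup m v)"

text \<open>Exponents vanish outside the keys, so the extra factors are 1. Monomials with different
  supports can thus be compared over one index set.\<close>

lemma monom_eval_superset:
  assumes "finite V" "Poly_Mapping.keys m \<subseteq> V"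
  shows "monom_eval x m = (\<Prod>v\<in>V. x v ^ Poly_Mapping.lookup m v)"
  unfolding monom_eval_def
  by (rule prod.mono_neutral_left) (use assms in \<open>auto simp: in_keys_iff\<close>)

lemma monom_eval_add: "monom_eval x (m + n) = monom_eval x m * monom_eval x n"
proof -
  let ?V = "Poly_Mapping.keys m \<union> Poly_Mapping.keys n"
  have "monom_eval x (m + n) = (\<Prod>v\<in>?V. x v ^ Poly_Mapping.lookup (m + n) v)"
    by (rule monom_eval_superset) (use keys_add[of m n] in auto)
  also have "\<dots> = monom_eval x m * monom_eval x n"
    by (simp add: monom_eval_superset[of ?V] lookup_add power_add prod.distrib)
  finally show ?thesis .
qed

lemma monom_eval_zero [simp]: "monom_eval x 0 = 1"
  by (simp add: monom_eval_def)

lemma monom_eval_single [simp]: "monom_eval x (Poly_Mapping.single v k) = x v ^ k"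
  by (cases "k = 0") (simp_all add: monom_eval_def)

text \<open>\<open>h\<close> is the structure map of a commutative algebra over the complex numbers.
  The identity gives evaluation at points and \<open>pconst\<close> gives substitution of
  polynomials, so the homomorphism laws are proved once for both.\<close>

locale complex_algebra =
  fixes h :: "complex \<Rightarrow> 'r::comm_ring_1"
  assumes h_one: "h 1 = 1"
    and h_add: "h (a + b) = h a + h b"
    and h_mult: "h (a * b) = h a * h b"
begin

lemma h_zero: "h 0 = 0"
  using h_add[of 0 0] by simp

definition aeval :: "('v \<Rightarrow> 'r) \<Rightarrow> 'v cpoly \<Rightarrow> 'r" where
  "aeval x f = (\<Sum>m\<in>Poly_Mapping.keys f. h (Poly_Mapping.lookup f m) * monom_eval x m)"

lemma aeval_single [simp]: "aeval x (Poly_Mapping.single m c) = h c * monom_eval x m"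
  by (cases "c = 0") (simp_all add: aeval_def h_zero)

lemma aeval_add [simp]: "aeval x (f + g) = aeval x f + aeval x g"
  \<comment> \<open>Cancellation can make the keys of \<open>f + g\<close> smaller than the union of
    the two key sets, but a vanishing coefficient contributes \<open>h 0 = 0\<close>.\<close>
  unfolding aeval_def by (rule setsum_keys_plus_distrib) (simp_all add: h_zero h_add distrib_right)

lemma aeval_mult [simp]: "aeval x (f * g) = aeval x f * aeval x g"
proof (induction f rule: cpoly_monomial_induct)
  case (single m c)
  show ?case
    by (induction g rule: cpoly_monomial_induct)
      (simp_all add: mult_single h_mult monom_eval_add distrib_left)
qed (simp add: distrib_right)

lemma aeval_pconst [simp]: "aeval x (pconst c) = h c"
  by (simp add: pconst_def)

lemma aeval_pvar [simp]: "aeval x (pvar v) = x v"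
  by (simp add: pvar_def h_one)

lemma aeval_zero [simp]: "aeval x 0 = 0"
  by (simp add: aeval_def)

lemma aeval_one [simp]: "aeval x 1 = 1"
  using aeval_pconst[of x 1] by (simp add: pconst_def h_one)

lemma aeval_numeral [simp]: "aeval x (numeral n) = numeral n"
  by (induction n) (simp_all only: numeral.simps aeval_add aeval_one)

lemma aeval_uminus [simp]: "aeval x (- f) = - aeval x f"
  by (rule minus_unique[symmetric]) (simp flip: aeval_add)

lemma aeval_diff [simp]: "aeval x (f - g) = aeval x f - aeval x g"
  using aeval_add[of x f "- g"] by simp

end

lemma pconst_add: "pconst (a + b) = pconst a + pconst b"
  by (simp add: pconst_def single_add)

lemma pconst_mult: "pconst (a * b) = pconst a * pconst b"
  by (simp add: pconst_def mult_single)

lemma pconst_one: "pconst 1 = 1"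
  by (simp add: pconst_def)

interpretation eval: complex_algebra "\<lambda>c. c"
  by standard simp_all

interpretation subst: complex_algebra "pconst :: complex \<Rightarrow> 'w cpoly"
  by standard (simp_all add: pconst_one pconst_add pconst_mult)

abbreviation psubst :: "('v \<Rightarrow> 'w cpoly) \<Rightarrow> 'v cpoly \<Rightarrow> 'w cpoly" where
  "psubst \<equiv> subst.aeval"

lemma peval_eq_aeval: "peval = eval.aeval"
  by (simp add: fun_eq_iff peval_def eval.aeval_def monom_eval_def)

text \<open>Constants and variables generate the polynomial ring: powers of a variable come first,
  then monomials, terms and sums. Substitutions can therefore be compared on the variables
  alone.\<close>

lemma cpoly_induct [case_names const var add mult]:
  fixes f :: "'v cpoly"
  assumes const: "\<And>c. P (pconst c)" and var: "\<And>v. P (pvar v)"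
    and add: "\<And>f g. P f \<Longrightarrow> P g \<Longrightarrow> P (f + g)" and mult: "\<And>f g. P f \<Longrightarrow> P g \<Longrightarrow> P (f * g)"
  shows "P f"
proof -
  have pow: "P (Poly_Mapping.single (Poly_Mapping.single v k) 1)" for v k
  proof (induction k)
    case (Suc k)
    have "Poly_Mapping.single (Poly_Mapping.single v (Suc k)) 1
      = Poly_Mapping.single (Poly_Mapping.single v k) (1 :: complex) * pvar v"
      by (simp add: pvar_def mult_single flip: single_add)
    then show ?case
      using mult[OF Suc var] by simp
  qed (use const[of 1] in \<open>simp add: pconst_def\<close>)
  have mon: "P (Poly_Mapping.single m 1)" for m :: "'v \<Rightarrow>\<^sub>0 nat"
  proof -
    have "P (Poly_Mapping.single (\<Sum>v\<in>V. Poly_Mapping.single v (Poly_Mapping.lookup m v)) 1)"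
      if "finite V" for V
      using that
    proof induction
      case (insert v V)
      then show ?case
        using mult[OF pow insert.IH, of v "Poly_Mapping.lookup m v"] by (simp add: mult_single)
    qed (use const[of 1] in \<open>simp add: pconst_def\<close>)
    moreover have "m = (\<Sum>v\<in>Poly_Mapping.keys m. Poly_Mapping.single v (Poly_Mapping.lookup m v))"
      by (rule poly_mapping_eqI) (simp add: lookup_sum lookup_single when_def in_keys_iff)
    ultimately show ?thesis
      by (metis finite_keys)
  qed
  show ?thesis
  proof (induction f rule: cpoly_monomial_induct)
    case (single m c)
    then show ?case
      using mult[OF const mon, of c m] by (simp add: pconst_def mult_single)
  qed (rule add)
qed


section \<open>Partial derivatives\<close>

lemma partial_deriv_single [simp]:
  "partial_deriv v (Poly_Mapping.single m c) =
     Poly_Mapping.single (m - Poly_Mapping.single v 1) (of_nat (Poly_Mapping.lookup m v) * c)"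
  by (cases "c = 0") (simp_all add: partial_deriv_def)

lemma partial_deriv_add [simp]: "partial_deriv v (f + g) = partial_deriv v f + partial_deriv v g"
  unfolding partial_deriv_def
  by (rule setsum_keys_plus_distrib) (simp_all add: distrib_left single_add)

lemma partial_deriv_zero [simp]: "partial_deriv v 0 = 0"
  by (simp add: partial_deriv_def)

lemma partial_deriv_uminus [simp]: "partial_deriv v (- f) = - partial_deriv v f"
  by (rule minus_unique[symmetric]) (simp flip: partial_deriv_add)

lemma partial_deriv_diff [simp]: "partial_deriv v (f - g) = partial_deriv v f - partial_deriv v g"
  using partial_deriv_add[of v f "- g"] by simp

lemma partial_deriv_pvar [simp]: "partial_deriv v (pvar w) = (if v = w then 1 else 0)"
  by (simp add: pvar_def lookup_single when_def)

lemma partial_deriv_one [simp]: "partial_deriv v 1 = 0"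
  using partial_deriv_single[of v 0 1] by (simp del: partial_deriv_single)

lemma partial_deriv_single_mult:
  "partial_deriv v (Poly_Mapping.single m a * Poly_Mapping.single n b) =
     partial_deriv v (Poly_Mapping.single m a) * Poly_Mapping.single n b +
     Poly_Mapping.single m a * partial_deriv v (Poly_Mapping.single n b)"
proof -
  let ?e = "Poly_Mapping.single v (1::nat)"
  \<comment> \<open>If \<open>v\<close> does not occur in \<open>k\<close>, both coefficients are 0;
    otherwise the truncated subtraction is exact and commutes with adding \<open>l\<close>.\<close>
  have shift: "Poly_Mapping.single (k + l - ?e) (of_nat (Poly_Mapping.lookup k v) * c) =
    Poly_Mapping.single (k - ?e + l) (of_nat (Poly_Mapping.lookup k v) * c)"
    for k l :: "'a \<Rightarrow>\<^sub>0 nat" and c :: complex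
  proof (cases "Poly_Mapping.lookup k v = 0")
    case False
    have "k + l - ?e = k - ?e + l"
      by (rule poly_mapping_eqI) (use False in \<open>auto simp: lookup_add lookup_minus lookup_single when_def\<close>)
    then show ?thesis by simp
  qed simp
  show ?thesis
    using shift[of m n "a * b"] shift[of n m "a * b"]
    by (simp add: mult_single lookup_add distrib_left distrib_right single_add ac_simps)
qed

lemma partial_deriv_mult [simp]:
  "partial_deriv v (f * g) = partial_deriv v f * g + f * partial_deriv v g"
proof (induction f rule: cpoly_monomial_induct)
  case (single m a)
  show ?case
    by (induction g rule: cpoly_monomial_induct)
      (simp_all only: partial_deriv_single_mult partial_deriv_add distrib_left add_ac)
qed (simp add: algebra_simps)

section \<open>Non-singularity of the two cubic surfaces\<close>

lemma nonsingular_cubic_D8: "nonsingular_hypersurface cubic_D8"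
  unfolding nonsingular_hypersurface_def
proof (intro allI impI)
  fix P assume P: "peval P cubic_D8 = 0"
  show "\<exists>v. peval P (partial_deriv v cubic_D8) \<noteq> 0"
  proof (rule ccontr)
    assume "\<not> ?thesis"
    then have "peval P (partial_deriv X1 cubic_D8) = 0" "peval P (partial_deriv X2 cubic_D8) = 0"
      "peval P (partial_deriv X3 cubic_D8) = 0"
      by blast+
    \<comment> \<open>The derivatives are x2 x3 + 2 x1, x1 x3 - 2 x2 and x1 x2. Once x1 x2 = 0, the
      first two force x1 = x2 = 0, where the cubic has the value -1.\<close>
    with P show False
      by (auto simp: peval_eq_aeval cubic_D8_def power2_eq_square)
  qed
qed

lemma nonsingular_cubic_PI: "nonsingular_hypersurface cubic_PI"
  unfolding nonsingular_hypersurface_def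
proof (intro allI impI)
  fix P assume P: "peval P cubic_PI = 0"
  show "\<exists>v. peval P (partial_deriv v cubic_PI) \<noteq> 0"
  proof (rule ccontr)
    assume "\<not> ?thesis"
    then have "peval P (partial_deriv S3 cubic_PI) = 0" "peval P (partial_deriv S4 cubic_PI) = 0"
      "peval P (partial_deriv S5 cubic_PI) = 0"
      by blast+
    \<comment> \<open>The derivatives are a4 a5 + 1, a3 a5 and a3 a4 + 1. If a3 a5 = 0, one of the
      other two equals 1.\<close>
    with P show False
      by (auto simp: peval_eq_aeval cubic_PI_def)
  qed
qed


section \<open>Coordinate rings\<close>

abbreviation gen_ideal :: "'v cpoly set \<Rightarrow> 'v cpoly set" where
  "gen_ideal F \<equiv> Idl\<^bsub>cpoly_ring\<^esub> F"

lemma cpoly_ring_simps [simp]: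
  "carrier cpoly_ring = UNIV" "x \<otimes>\<^bsub>cpoly_ring\<^esub> y = x * y" "\<one>\<^bsub>cpoly_ring\<^esub> = 1"
  "\<zero>\<^bsub>cpoly_ring\<^esub> = 0" "x \<oplus>\<^bsub>cpoly_ring\<^esub> y = x + y"
  by (simp_all add: cpoly_ring_def)

lemma ring_cpoly_ring: "ring cpoly_ring"
  using cring_cpoly_ring by (rule cring.axioms)

lemma cpoly_ring_minus [simp]: "x \<ominus>\<^bsub>cpoly_ring\<^esub> y = x - y" for x y :: "'v cpoly"
proof -
  interpret ring "cpoly_ring :: 'v cpoly ring" by (rule ring_cpoly_ring)
  have "\<ominus>\<^bsub>cpoly_ring\<^esub> y = - y"
    by (rule minus_equality) simp_all
  then show ?thesis by (simp add: a_minus_def)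
qed

lemma ideal_gen_ideal: "ideal (gen_ideal F) cpoly_ring"
  by (rule ring.genideal_ideal[OF ring_cpoly_ring]) simp

lemma gen_ideal_incl: "f \<in> F \<Longrightarrow> f \<in> gen_ideal F"
  using ring.genideal_self[OF ring_cpoly_ring, of F] by auto

lemma gen_ideal_add: "f \<in> gen_ideal F \<Longrightarrow> g \<in> gen_ideal F \<Longrightarrow> f + g \<in> gen_ideal F"
  using additive_subgroup.a_closed[OF ideal.axioms(1)[OF ideal_gen_ideal]] by fastforce

lemma gen_ideal_mult: "f \<in> gen_ideal F \<Longrightarrow> g * f \<in> gen_ideal F"
  using ideal.I_l_closed[OF ideal_gen_ideal, of f F g] by simp

lemma gen_ideal_zero: "0 \<in> gen_ideal F"
  using additive_subgroup.zero_closed[OF ideal.axioms(1)[OF ideal_gen_ideal]] by fastforce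

lemma gen_ideal_uminus: "f \<in> gen_ideal F \<Longrightarrow> - f \<in> gen_ideal F"
  using gen_ideal_mult[of f F "- 1"] by simp

lemma gen_ideal_diff: "f \<in> gen_ideal F \<Longrightarrow> g \<in> gen_ideal F \<Longrightarrow> f - g \<in> gen_ideal F"
  using gen_ideal_add[of f F "- g"] gen_ideal_uminus[of g F] by simp

lemma coord_class_eq_iff: "coord_class F f = coord_class F g \<longleftrightarrow> f - g \<in> gen_ideal F"
  using ring.quotient_eq_iff_same_a_r_cos[OF ring_cpoly_ring ideal_gen_ideal, of f g F]
  by (simp add: coord_class_def)

lemma coord_class_psubst_hom:
  "ring_hom_ring cpoly_ring (coord_ring G) (\<lambda>f. coord_class G (psubst \<sigma> f))"
proof (rule ring_hom_ringI2[OF ring_cpoly_ring])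
  show "ring (coord_ring G)"
    unfolding coord_ring_def by (rule ideal.quotient_is_ring[OF ideal_gen_ideal])
  have hom: "coord_class G \<in> ring_hom cpoly_ring (coord_ring G)"
    using ideal.rcos_ring_hom[OF ideal_gen_ideal, of G]
    unfolding coord_ring_def coord_class_def[abs_def] .
  show "(\<lambda>f. coord_class G (psubst \<sigma> f)) \<in> ring_hom cpoly_ring (coord_ring G)"
    using ring_hom_closed[OF hom] ring_hom_mult[OF hom] ring_hom_add[OF hom] ring_hom_one[OF hom]
    by (intro ring_hom_memI)
      (simp_all only: cpoly_ring_simps subst.aeval_add subst.aeval_mult subst.aeval_one UNIV_I)
qed

text \<open>Seeing the pulled-back ideal as a kernel shows that it is an ideal and prepares the
  first isomorphism theorem.\<close>

lemma kernel_coord_class_psubst: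
  "a_kernel cpoly_ring (coord_ring G) (\<lambda>f. coord_class G (psubst \<sigma> f)) =
    {f. psubst \<sigma> f \<in> gen_ideal G}"
proof -
  have "\<zero>\<^bsub>coord_ring G\<^esub> = coord_class G 0"
    using ring_hom_zero[OF ring_hom_ring.homh[OF coord_class_psubst_hom] ring_cpoly_ring
        ring_hom_ring.axioms(2)[OF coord_class_psubst_hom], of G \<sigma>]
    by (simp only: cpoly_ring_simps subst.aeval_zero)
  then show ?thesis
    by (simp add: a_kernel_def' coord_class_eq_iff)
qed

section \<open>Substitutions modulo ideals and the induced isomorphisms\<close>

lemma psubst_gen_ideal:
  assumes "\<And>f. f \<in> F \<Longrightarrow> psubst \<sigma> f \<in> gen_ideal G" and "f \<in> gen_ideal F"
  shows "psubst \<sigma> f \<in> gen_ideal G"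
proof -
  \<comment> \<open>The pulled-back ideal contains \<open>F\<close>, and \<open>gen_ideal F\<close>
    is the least ideal that does; so checking generators suffices.\<close>
  have "ideal {f. psubst \<sigma> f \<in> gen_ideal G} cpoly_ring"
    using ring_hom_ring.kernel_is_ideal[OF coord_class_psubst_hom, of G \<sigma>]
    by (simp only: kernel_coord_class_psubst)
  then have "gen_ideal F \<subseteq> {f. psubst \<sigma> f \<in> gen_ideal G}"
    by (rule ring.genideal_minimal[OF ring_cpoly_ring]) (use assms(1) in blast)
  with assms(2) show ?thesis by blast
qed

lemma psubst_inverse_mod_ideal:
  assumes "\<And>v. psubst \<tau> (\<sigma> v) - pvar v \<in> gen_ideal F"
  shows "psubst \<tau> (psubst \<sigma> f) - f \<in> gen_ideal F"
proof (induction f rule: cpoly_induct)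
  case (add f g)
  then show ?case
    using gen_ideal_add[OF add] by (simp add: add_diff_add)
next
  case (mult f g)
  \<comment> \<open>Each summand contains one of the two differences covered by the induction
    hypotheses.\<close>
  have "psubst \<tau> (psubst \<sigma> (f * g)) - f * g =
    psubst \<tau> (psubst \<sigma> f) * (psubst \<tau> (psubst \<sigma> g) - g) + g * (psubst \<tau> (psubst \<sigma> f) - f)"
    by (simp add: algebra_simps)
  then show ?case
    by (simp only:) (intro gen_ideal_add gen_ideal_mult mult)
qed (use assms gen_ideal_zero in auto)

text \<open>First isomorphism theorem for \<open>h\<close>: since \<sigma> respects the relations,
  \<open>gen_ideal F\<close> lies in the kernel; \<tau> as a left inverse gives the converse
  inclusion, and as a right inverse it gives surjectivity.\<close>

lemma algebra_iso_of_substitutions: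
  assumes \<sigma>: "\<And>f. f \<in> F \<Longrightarrow> psubst \<sigma> f \<in> gen_ideal G"
    and \<tau>: "\<And>g. g \<in> G \<Longrightarrow> psubst \<tau> g \<in> gen_ideal F"
    and \<tau>\<sigma>: "\<And>v. psubst \<tau> (\<sigma> v) - pvar v \<in> gen_ideal F"
    and \<sigma>\<tau>: "\<And>w. psubst \<sigma> (\<tau> w) - pvar w \<in> gen_ideal G"
  shows "\<exists>\<phi>\<in>algebra_iso F G. \<forall>f. \<phi> (coord_class F f) = coord_class G (psubst \<sigma> f)"
proof -
  define h where "h = (\<lambda>f. coord_class G (psubst \<sigma> f))"
  interpret h: ring_hom_ring cpoly_ring "coord_ring G" h
    unfolding h_def by (rule coord_class_psubst_hom)
  have "psubst \<sigma> f \<in> gen_ideal G \<longleftrightarrow> f \<in> gen_ideal F" for f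
  proof
    assume "psubst \<sigma> f \<in> gen_ideal G"
    then have "psubst \<tau> (psubst \<sigma> f) \<in> gen_ideal F"
      using psubst_gen_ideal[of G \<tau> F] \<tau> by blast
    from gen_ideal_diff[OF this psubst_inverse_mod_ideal[OF \<tau>\<sigma>, of f]]
    show "f \<in> gen_ideal F" by simp
  qed (use psubst_gen_ideal[of F \<sigma> G] \<sigma> in blast)
  then have ker: "a_kernel cpoly_ring (coord_ring G) h = gen_ideal F"
    by (simp add: h_def kernel_coord_class_psubst)
  have "h ` carrier cpoly_ring = carrier (coord_ring G)"
  proof -
    have "carrier (coord_ring G) = range (coord_class G)"
      by (auto simp: coord_ring_def coord_class_def FactRing_def A_RCOSETS_def')
    moreover have "h (psubst \<tau> g) = coord_class G g" for g
      using psubst_inverse_mod_ideal[OF \<sigma>\<tau>, of g] by (simp add: h_def coord_class_eq_iff)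
    then have "range (coord_class G) \<subseteq> range h"
      by (metis image_subsetI rangeI)
    moreover have "range h \<subseteq> range (coord_class G)"
      by (auto simp: h_def)
    ultimately show ?thesis by (simp only: cpoly_ring_simps subset_antisym)
  qed
  \<comment> \<open>\<open>h\<close> is constant on each coset of its kernel, and
    \<open>the_elem\<close> extracts that common value.\<close>
  then have iso: "(\<lambda>X. the_elem (h ` X)) \<in> ring_iso (coord_ring F) (coord_ring G)"
    unfolding coord_ring_def[of F] ker[symmetric] by (rule h.FactRing_iso_set)
  have val: "the_elem (h ` coord_class F f) = coord_class G (psubst \<sigma> f)" for f
  proof -
    have "the_elem (h ` coord_class F f) = h f"
      unfolding coord_class_def ker[symmetric]
      by (rule h.the_elem_simp) (simp only: cpoly_ring_simps UNIV_I)
    then show ?thesis by (simp only: h_def)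
  qed
  show ?thesis
  proof (intro bexI allI)
    show "the_elem (h ` coord_class F f) = coord_class G (psubst \<sigma> f)" for f
      by (rule val)
    \<comment> \<open>Compatibility with complex scalars holds because substitution fixes
      constants.\<close>
    show "(\<lambda>X. the_elem (h ` X)) \<in> algebra_iso F G"
      unfolding algebra_iso_def using iso by (simp only: mem_Collect_eq val subst.aeval_pconst simp_thms)
  qed
qed


section \<open>The matrix relations\<close>

lemma mat22_nth [simp]:
  "mat22 a b c d $ 1 $ 1 = a" "mat22 a b c d $ 1 $ 2 = b"
  "mat22 a b c d $ 2 $ 1 = c" "mat22 a b c d $ 2 $ 2 = d"
  by (simp_all add: mat22_def)

lemma mat22_mult:
  fixes a b c d :: "'a::comm_ring_1"
  shows "mat22 a b c d ** mat22 a' b' c' d' =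
    mat22 (a * a' + b * c') (a * b' + b * d') (c * a' + d * c') (c * b' + d * d')"
  by (simp only: vec_eq_iff forall_2 matrix_matrix_mult_def sum_2 vec_lambda_beta mat22_nth)

lemma matrix_relations_mat22:
  "matrix_relations (mat22 a b c d) (mat22 a' b' c' d') = {a - a', b - b', c - c', d - d'}"
proof -
  have ex_2: "(\<exists>i. P i) \<longleftrightarrow> P 1 \<or> P 2" for P :: "2 \<Rightarrow> bool"
    using forall_2[of "\<lambda>i. \<not> P i"] by blast
  show ?thesis
    unfolding matrix_relations_def ex_2 mat22_nth by auto
qed

lemma relations_D8_eq:
  "relations_D8 =
    {pvar L1 * pvar L4 - pvar L2 * pvar L3 - 1,
     - (pvar L1 * pvar A) + pvar L2 + pvar B * pvar L1 + pvar L3,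
     - pvar L1 + pvar B * pvar L2 + pvar L4,
     - (pvar L3 * pvar A) + pvar L4 - pvar L1,
     - pvar L3 - pvar L2}"
  by (simp add: relations_D8_def mat22_mult matrix_relations_mat22 algebra_simps insert_commute)

text \<open>The entries of \<open>M N = 1\<close>, for \<open>M\<close> and \<open>N\<close> the products of the first and last three factors.\<close>

lemma relations_PI_eq:
  "relations_PI =
    {- pvar A1 * (1 + pvar A4 * pvar A5)
       - (1 + pvar A1 * pvar A2) * (pvar A3 + pvar A5 + pvar A3 * pvar A4 * pvar A5) - 1,
     - pvar A1 * pvar A4 - (1 + pvar A1 * pvar A2) * (1 + pvar A3 * pvar A4),
     1 + pvar A4 * pvar A5 + pvar A2 * (pvar A3 + pvar A5 + pvar A3 * pvar A4 * pvar A5),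
     pvar A4 + pvar A2 * (1 + pvar A3 * pvar A4) - 1}"
  (is "_ = ?R")
proof -
  have "relations_PI = matrix_relations
    (mat22 (- pvar A1) (- (1 + pvar A1 * pvar A2)) 1 (pvar A2) **
      (mat22 1 0 (pvar A3) 1 ** (mat22 1 (pvar A4) 0 1 ** mat22 1 0 (pvar A5) 1)))
    (mat22 1 0 0 1)"
    by (simp add: relations_PI_def mat22_mult algebra_simps)
  also have "\<dots> = ?R"
    unfolding mat22_mult matrix_relations_mat22
    by (rule arg_cong2[where f = insert] | simp add: algebra_simps)+
  finally show ?thesis .
qed


section \<open>The two isomorphisms\<close>

lemma ideal_D8:
  shows "pvar L3 + pvar L2 \<in> gen_ideal relations_D8"
    and "pvar L4 - pvar L1 + pvar A * pvar L2 \<in> gen_ideal relations_D8"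
    and "pvar B - pvar A \<in> gen_ideal relations_D8"
    and "pvar L1 ^ 2 - pvar A * pvar L1 * pvar L2 + pvar L2 ^ 2 - 1 \<in> gen_ideal relations_D8"
proof -
  define d r11 r12 r21 r22 :: "coords_D8 cpoly" where
    "d = pvar L1 * pvar L4 - pvar L2 * pvar L3 - 1" and
    "r11 = - (pvar L1 * pvar A) + pvar L2 + pvar B * pvar L1 + pvar L3" and
    "r12 = - pvar L1 + pvar B * pvar L2 + pvar L4" and
    "r21 = - (pvar L3 * pvar A) + pvar L4 - pvar L1" and
    "r22 = - pvar L3 - pvar L2"
  note r_defs = d_def r11_def r12_def r21_def r22_def
  have gen: "d \<in> gen_ideal relations_D8" "r11 \<in> gen_ideal relations_D8"
    "r12 \<in> gen_ideal relations_D8" "r21 \<in> gen_ideal relations_D8" "r22 \<in> gen_ideal relations_D8"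
    by (rule gen_ideal_incl, simp only: relations_D8_eq r_defs insert_iff simp_thms)+
  note mem = gen gen_ideal_add gen_ideal_mult gen_ideal_diff gen_ideal_uminus
  have "pvar L3 + pvar L2 = - r22"
    by (simp add: r_defs)
  then show "pvar L3 + pvar L2 \<in> gen_ideal relations_D8"
    by (simp only:) (intro mem)
  have "pvar L4 - pvar L1 + pvar A * pvar L2 = r21 - pvar A * r22"
    by (simp add: r_defs algebra_simps)
  then show "pvar L4 - pvar L1 + pvar A * pvar L2 \<in> gen_ideal relations_D8"
    by (simp only:) (intro mem)
  \<comment> \<open>The factors in parentheses are (b - a) l1 and (b - a) l2, and 1 = l1 l4 - l2 l3
    - \<open>d\<close>.\<close>
  have B_minus_A: "pvar B - pvar A =
    pvar L4 * (r11 + r22) - pvar L3 * (r12 - r21 + pvar A * r22) - (pvar B - pvar A) * d"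
    by (simp add: r_defs algebra_simps)
  show "pvar B - pvar A \<in> gen_ideal relations_D8"
    by (subst B_minus_A) (intro mem)
  \<comment> \<open>The corrections to \<open>d\<close> replace l4 by l1 - a l2 and l3 by - l2 in
    the determinant.\<close>
  have "pvar L1 ^ 2 - pvar A * pvar L1 * pvar L2 + pvar L2 ^ 2 - 1 =
    d - pvar L1 * (r21 - pvar A * r22) - pvar L2 * r22"
    by (simp add: r_defs algebra_simps power2_eq_square)
  then show "pvar L1 ^ 2 - pvar A * pvar L1 * pvar L2 + pvar L2 ^ 2 - 1 \<in> gen_ideal relations_D8"
    by (simp only:) (intro mem)
qed

lemma affine_schemes_iso_D8: "affine_schemes_iso relations_D8 {cubic_D8}"
proof -
  have I_sq: "pconst \<i> * pconst \<i> = (- 1 :: 'v cpoly)"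
    by (simp add: single_uminus pconst_def mult_single)
  have I_sq': "pconst \<i> * (pconst \<i> * f) = - f" for f :: "'v cpoly"
    by (simp flip: mult.assoc add: I_sq)
  \<comment> \<open>The imaginary unit in x2 turns l2^2 into - x2^2; a second one in x3 makes x1 x2
    x3 equal to - a l1 l2.\<close>
  define \<sigma> :: "coords_x \<Rightarrow> coords_D8 cpoly" where
    "\<sigma> = case_coords_x (pvar L1) (pconst \<i> * pvar L2) (pconst \<i> * pvar A)"
  \<comment> \<open>Solving for l1, l2 and a and then using b = a, l3 = - l2, l4 = l1 - a l2 gives
    these values.\<close>
  define \<tau> :: "coords_D8 \<Rightarrow> coords_x cpoly" where
    "\<tau> = case_coords_D8 (- (pconst \<i> * pvar X3)) (- (pconst \<i> * pvar X3))
      (pvar X1) (- (pconst \<i> * pvar X2)) (pconst \<i> * pvar X2) (pvar X1 + pvar X2 * pvar X3)"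
  have "\<exists>\<phi>\<in>algebra_iso {cubic_D8} relations_D8.
    \<forall>f. \<phi> (coord_class {cubic_D8} f) = coord_class relations_D8 (psubst \<sigma> f)"
  proof (rule algebra_iso_of_substitutions)
    fix f assume "f \<in> {cubic_D8}"
    then have "psubst \<sigma> f = pvar L1 ^ 2 - pvar A * pvar L1 * pvar L2 + pvar L2 ^ 2 - 1"
      by (simp add: \<sigma>_def cubic_D8_def power2_eq_square I_sq I_sq' ac_simps)
    with ideal_D8(4) show "psubst \<sigma> f \<in> gen_ideal relations_D8"
      by simp
  next
    \<comment> \<open>The determinant relation becomes the cubic; the four matrix entries become
      0.\<close>
    have "\<forall>g\<in>relations_D8. psubst \<tau> g \<in> {0, cubic_D8}"
      by (simp add: relations_D8_eq \<tau>_def cubic_D8_def power2_eq_square I_sq I_sq' algebra_simps)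
    then show "psubst \<tau> g \<in> gen_ideal {cubic_D8}" if "g \<in> relations_D8" for g
      using that gen_ideal_zero gen_ideal_incl[of cubic_D8 "{cubic_D8}"] by force
  next
    fix v
    have "psubst \<tau> (\<sigma> v) = pvar v"
      by (cases v) (simp_all add: \<sigma>_def \<tau>_def I_sq')
    then show "psubst \<tau> (\<sigma> v) - pvar v \<in> gen_ideal {cubic_D8}"
      by (simp add: gen_ideal_zero)
  next
    fix w
    \<comment> \<open>The difference is 0 for \<open>A\<close>, \<open>L1\<close>,
      \<open>L2\<close>; for \<open>B\<close>, \<open>L3\<close>, \<open>L4\<close> it is the
      negative of an element from \<open>ideal_D8\<close>.\<close>
    show "psubst \<sigma> (\<tau> w) - pvar w \<in> gen_ideal relations_D8"
      using gen_ideal_uminus[OF ideal_D8(1)] gen_ideal_uminus[OF ideal_D8(2)]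
        gen_ideal_uminus[OF ideal_D8(3)] gen_ideal_zero
      by (cases w) (simp_all add: \<sigma>_def \<tau>_def I_sq I_sq' algebra_simps)
  qed
  then show ?thesis
    by (auto simp: affine_schemes_iso_def)
qed

section \<open>The monodromy space for Painleve I\<close>

lemma ideal_PI:
  shows "pvar A1 + 1 + pvar A3 * pvar A4 \<in> gen_ideal relations_PI"
    and "pvar A2 - 1 - pvar A4 * pvar A5 \<in> gen_ideal relations_PI"
    and "pvar A3 * pvar A4 * pvar A5 + pvar A3 + pvar A5 + 1 \<in> gen_ideal relations_PI"
proof -
  define n11 n12 n21 n22 :: "coords_PI cpoly" where
    "n11 = 1 + pvar A4 * pvar A5" and
    "n12 = pvar A4" and
    "n21 = pvar A3 + pvar A5 + pvar A3 * pvar A4 * pvar A5" and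
    "n22 = 1 + pvar A3 * pvar A4"
  \<comment> \<open>These are the entries of M N - 1, where N has the entries \<open>n11\<close> to
    \<open>n22\<close>.\<close>
  define r11 r12 r21 r22 where
    "r11 = - pvar A1 * n11 - (1 + pvar A1 * pvar A2) * n21 - 1" and
    "r12 = - pvar A1 * n12 - (1 + pvar A1 * pvar A2) * n22" and
    "r21 = n11 + pvar A2 * n21" and
    "r22 = n12 + pvar A2 * n22 - 1"
  note n_defs = n11_def n12_def n21_def n22_def
  note r_defs = r11_def r12_def r21_def r22_def
  have gen: "r11 \<in> gen_ideal relations_PI" "r12 \<in> gen_ideal relations_PI"
    "r21 \<in> gen_ideal relations_PI" "r22 \<in> gen_ideal relations_PI"
    by (rule gen_ideal_incl, simp only: relations_PI_eq r_defs n_defs insert_iff simp_thms)+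
  note mem = gen gen_ideal_add gen_ideal_mult gen_ideal_diff gen_ideal_uminus
  \<comment> \<open>As det N = 1, (M N - 1) adj N = M - adj N. The three combinations below are its
    entries (1,1), up to sign, (2,2) and (2,1).\<close>
  have "pvar A1 + 1 + pvar A3 * pvar A4 = n21 * r12 - n22 * r11"
    by (simp add: r_defs n_defs algebra_simps)
  then show "pvar A1 + 1 + pvar A3 * pvar A4 \<in> gen_ideal relations_PI"
    by (simp only:) (intro mem)
  have "pvar A2 - 1 - pvar A4 * pvar A5 = n11 * r22 - n12 * r21"
    by (simp add: r_defs n_defs algebra_simps)
  then show "pvar A2 - 1 - pvar A4 * pvar A5 \<in> gen_ideal relations_PI"
    by (simp only:) (intro mem)
  have "pvar A3 * pvar A4 * pvar A5 + pvar A3 + pvar A5 + 1 = n22 * r21 - n21 * r22"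
    by (simp add: r_defs n_defs algebra_simps)
  then show "pvar A3 * pvar A4 * pvar A5 + pvar A3 + pvar A5 + 1 \<in> gen_ideal relations_PI"
    by (simp only:) (intro mem)
qed

lemma algebra_iso_PI:
  "\<exists>\<phi>\<in>algebra_iso {cubic_PI} relations_PI.
    \<phi> (coord_class {cubic_PI} (pvar S3)) = coord_class relations_PI (pvar A3) \<and>
    \<phi> (coord_class {cubic_PI} (pvar S4)) = coord_class relations_PI (pvar A4) \<and>
    \<phi> (coord_class {cubic_PI} (pvar S5)) = coord_class relations_PI (pvar A5)"
proof -
  define \<sigma> :: "coords_S \<Rightarrow> coords_PI cpoly" where
    "\<sigma> = case_coords_S (pvar A3) (pvar A4) (pvar A5)"
  define \<tau> :: "coords_PI \<Rightarrow> coords_S cpoly" where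
    "\<tau> = case_coords_PI (- 1 - pvar S3 * pvar S4) (1 + pvar S4 * pvar S5)
      (pvar S3) (pvar S4) (pvar S5)"
  have "\<exists>\<phi>\<in>algebra_iso {cubic_PI} relations_PI.
    \<forall>f. \<phi> (coord_class {cubic_PI} f) = coord_class relations_PI (psubst \<sigma> f)"
  proof (rule algebra_iso_of_substitutions)
    fix f assume "f \<in> {cubic_PI}"
    then show "psubst \<sigma> f \<in> gen_ideal relations_PI"
      using ideal_PI(3) by (simp add: \<sigma>_def cubic_PI_def)
  next
    \<comment> \<open>Here \<tau> sends a1 to - N22 and a2 to N11. By det N = 1, N11 N22 - 1 = N12
      N21, so each relation acquires the factor 1 + N21, which is the cubic.\<close>
    have "psubst \<tau> ` relations_PI =
      {pvar S4 * (pvar S3 + pvar S5 + pvar S3 * pvar S4 * pvar S5) * cubic_PI,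
       pvar S4 * (1 + pvar S3 * pvar S4) * cubic_PI,
       (1 + pvar S4 * pvar S5) * cubic_PI, pvar S4 * cubic_PI}"
      unfolding relations_PI_eq image_insert image_empty
      \<comment> \<open>The sets are compared element by element in the listed order, leaving one
        polynomial identity each.\<close>
      by (rule arg_cong2[where f = insert] | simp add: \<tau>_def cubic_PI_def algebra_simps)+
    then show "psubst \<tau> g \<in> gen_ideal {cubic_PI}" if "g \<in> relations_PI" for g
      using imageI[OF that, of "psubst \<tau>"]
      by (simp only:) (elim insertE emptyE; simp only: gen_ideal_mult gen_ideal_incl insertI1)
  next
    fix v
    show "psubst \<tau> (\<sigma> v) - pvar v \<in> gen_ideal {cubic_PI}"
      by (cases v) (simp_all add: \<sigma>_def \<tau>_def gen_ideal_zero)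
  next
    fix w
    \<comment> \<open>The difference is 0 except for \<open>A1\<close> and \<open>A2\<close>, where
      it is the negative of an element from \<open>ideal_PI\<close>.\<close>
    show "psubst \<sigma> (\<tau> w) - pvar w \<in> gen_ideal relations_PI"
      using gen_ideal_uminus[OF ideal_PI(1)] gen_ideal_uminus[OF ideal_PI(2)] gen_ideal_zero
      by (cases w) (simp_all add: \<sigma>_def \<tau>_def algebra_simps)
  qed
  then obtain \<phi> where "\<phi> \<in> algebra_iso {cubic_PI} relations_PI"
    and "\<And>f. \<phi> (coord_class {cubic_PI} f) = coord_class relations_PI (psubst \<sigma> f)"
    by blast
  then show ?thesis
    by (intro bexI[of _ \<phi>]) (simp_all add: \<sigma>_def)
qed

theorem mainTheorem7:
  shows "(affine_schemes_iso relations_D8 {cubic_D8} \<and> nonsingular_hypersurface cubic_D8) \<and>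
    ((\<exists>\<phi>\<in>algebra_iso {cubic_PI} relations_PI.
        \<phi> (coord_class {cubic_PI} (pvar S3)) = coord_class relations_PI (pvar A3) \<and>
        \<phi> (coord_class {cubic_PI} (pvar S4)) = coord_class relations_PI (pvar A4) \<and>
        \<phi> (coord_class {cubic_PI} (pvar S5)) = coord_class relations_PI (pvar A5)) \<and>
     nonsingular_hypersurface cubic_PI \<and>
     coord_class relations_PI (pvar A2) = coord_class relations_PI (1 + pvar A4 * pvar A5) \<and>
     coord_class relations_PI (pvar A1) = coord_class relations_PI (- 1 - pvar A3 * pvar A4))"
proof (intro conjI)
  show "coord_class relations_PI (pvar A2) = coord_class relations_PI (1 + pvar A4 * pvar A5)"
    using ideal_PI(2) by (simp add: coord_class_eq_iff algebra_simps)
  show "coord_class relations_PI (pvar A1) = coord_class relations_PI (- 1 - pvar A3 * pvar A4)"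
    using ideal_PI(1) by (simp add: coord_class_eq_iff algebra_simps)
qed (fact affine_schemes_iso_D8 nonsingular_cubic_D8 algebra_iso_PI nonsingular_cubic_PI)+

end
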